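(* Let $n\ge 1$, $\mathcal N=\{1,\dots,n\}$ and let $w:\mathbb R^n\to\overline{\mathbb R}$ be a function. The following statements are equivalent: 1. $w$ is a choice welfare function. 2. There exists a convex function $V:\Delta_{n-1}\to\overline{\mathbb R}$ such that for all $\mu\in\mathbb R^n$ $$w(\mu)=\max\{\mu^T x-V(x)\mid x\in\Delta_{n-1}\}.$$ 3. There exists a set $\Theta$ of distributions of the random vector $\epsilon=(\epsilon_1,\dots,\epsilon_n)$ such that for all $\mu\in\mathbb R^n$ $$w(\mu)=\sup_{\theta\in\Theta}\ \mathbb E_{\epsilon\sim\theta}\Big[\max_{i\in\mathcal N}(\mu_i+\epsilon_i)\Big].$$
   Context: $\overline{\mathbb R}=\mathbb R\cup\{-\infty,+\infty\}$; $\Delta_{n-1}=\{x\in\mathbb R^n\mid \sum_i x_i=1,\ x\ge 0\}$; $\mathbf e$ is the all-ones vector; inequalities between vectors are componentwise. A function $w:\mathbb R^n\to\overline{\mathbb R}$ is a choice welfare function if it satisfies: (Monotonicity) $w(\mu_1)\ge w(\mu_2)$ whenever $\mu_1\ge\mu_2$; (Translation invariance) $w(\mu+t\mathbf e)=w(\mu)+t$ for all $\mu\in\mathbb R^n$, $t\in\mathbb R$; (Convexity) $\lambda w(\mu_1)+(1-\lambda)w(\mu_2)\ge w(\lambda\mu_1+(1-\lambda)\mu_2)$ for all $\mu_1,\mu_2\in\mathbb R^n$ and $0\le\lambda\le1$. Usual conventions of extended real arithmetic are used (with $0\cdot(\pm\infty)=0$). Convexity of an extended-real-valued function means convexity of its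 epigraph. Regularization functions $V$ are assumed lower semicontinuous, so that the maximum in statement 2 is attained. Distributions in $\Theta$ are probability distributions on $\overline{\mathbb R}^n$ (the components $\epsilon_i$ may take the values $\pm\infty$), for which the expectation in statement 3 is well defined in $\overline{\mathbb R}$. *)

theory Defs
  imports "HOL-Probability.Probability"
begin

text \<open>
  The sum in the convexity condition is the one of type \<^typ>\<open>ereal\<close>, where
  \<^term>\<open>0 * \<infinity> = (0::ereal)\<close>. The value of the undetermined \<^term>\<open>\<infinity> + (- \<infinity>) :: ereal\<close> is
  irrelevant: a monotone and translation invariant function that is infinite at one point is
  constant.
\<close>

definition choice_welfare_function :: "(real ^ 'n \<Rightarrow> ereal) \<Rightarrow> bool" where
  "choice_welfare_function w \<longleftrightarrow>
     (\<forall>\<mu>1 \<mu>2. \<mu>1 \<ge> \<mu>2 \<longrightarrow> w \<mu>1 \<ge> w \<mu>2) \<and>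
     (\<forall>\<mu> (t::real). w (\<mu> + t *\<^sub>R (\<chi> i. 1)) = w \<mu> + ereal t) \<and>
     (\<forall>\<mu>1 \<mu>2 (a::real). 0 \<le> a \<longrightarrow> a \<le> 1 \<longrightarrow>
        ereal a * w \<mu>1 + ereal (1 - a) * w \<mu>2 \<ge> w (a *\<^sub>R \<mu>1 + (1 - a) *\<^sub>R \<mu>2))"

definition unit_simplex :: "(real ^ 'n) set" where
  "unit_simplex = {x. (\<Sum>i\<in>UNIV. x $ i) = 1 \<and> 0 \<le> x}"

text \<open>
  As usual in convex analysis, the epigraph of an extended-real-valued function has real
  heights only. The constants \<^const>\<open>epigraph\<close> and \<^const>\<open>convex_on\<close> cover real-valued
  functions only.
\<close>

definition ereal_epigraph :: "'a set \<Rightarrow> ('a \<Rightarrow> ereal) \<Rightarrow> ('a \<times> real) set" where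
  "ereal_epigraph S f = {(x, r). x \<in> S \<and> f x \<le> ereal r}"

definition ereal_convex_on :: "'a::real_vector set \<Rightarrow> ('a \<Rightarrow> ereal) \<Rightarrow> bool" where
  "ereal_convex_on S f \<longleftrightarrow> convex (ereal_epigraph S f)"

definition lower_semicontinuous_on :: "'a::topological_space set \<Rightarrow> ('a \<Rightarrow> ereal) \<Rightarrow> bool" where
  "lower_semicontinuous_on S f \<longleftrightarrow> (\<forall>x\<in>S. f x \<le> Liminf (at x within S) f)"

text \<open>An attained supremum; \<^const>\<open>Max\<close> is meaningful for finite sets only.\<close>

definition is_maximum :: "'a::order \<Rightarrow> 'a set \<Rightarrow> bool" where
  "is_maximum m A \<longleftrightarrow> m \<in> A \<and> (\<forall>a\<in>A. a \<le> m)"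

text \<open>
  The Bochner integral does not cover extended-real-valued functions. The expectation is the
  integral of the positive part minus that of the negative part (\<^const>\<open>e2ennreal\<close> sends
  negative numbers to zero); it is well defined in the extended reals if these are not both
  infinite.
\<close>

definition ereal_expectation :: "'a measure \<Rightarrow> ('a \<Rightarrow> ereal) \<Rightarrow> ereal" where
  "ereal_expectation M f =
     enn2ereal (\<integral>\<^sup>+ x. e2ennreal (f x) \<partial>M) - enn2ereal (\<integral>\<^sup>+ x. e2ennreal (- f x) \<partial>M)"

definition has_ereal_expectation :: "'a measure \<Rightarrow> ('a \<Rightarrow> ereal) \<Rightarrow> bool" where
  "has_ereal_expectation M f \<longleftrightarrow>
     f \<in> borel_measurable M \<and>
     ((\<integral>\<^sup>+ x. e2ennreal (f x) \<partial>M) < \<infinity> \<or> (\<integral>\<^sup>+ x. e2ennreal (- f x) \<partial>M) < \<infinity>)"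

definition max_utility :: "real ^ 'n \<Rightarrow> ereal ^ 'n \<Rightarrow> ereal" where
  "max_utility \<mu> \<epsilon> = (MAX i. ereal (\<mu> $ i) + \<epsilon> $ i)"

definition admissible_distribution :: "(ereal ^ 'n) measure \<Rightarrow> bool" where
  "admissible_distribution \<theta> \<longleftrightarrow>
     prob_space \<theta> \<and> sets \<theta> = sets borel \<and>
     (\<forall>\<mu>. has_ereal_expectation \<theta> (max_utility \<mu>))"

end

theory Submission
  imports Defs
begin

text \<open>
  Choice welfare functions are closed under pointwise suprema
  (\<open>choice_welfare_function_SUP\<close>), and this shows that both representations yield choice
  welfare functions: the maps \<^term>\<open>\<lambda>\<mu>. ereal (\<mu> \<bullet> x) - c\<close> with \<open>x\<close> in the simplex and a
  possibly infinite \<open>c\<close> are choice welfare functions, and so is the expected maximal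
  utility under a single distribution. For the latter
  (\<open>choice_welfare_function_expectation\<close>), note that a monotone and translation invariant function
  that is infinite somewhere is constant (\<open>infinite_imp_constant\<close>). An expected maximal utility is
  therefore either constant, or finite at every \<open>\<mu>\<close>; in the second case it is an integral of almost
  surely finite functions, and its convexity is the pointwise convexity of the maximum.

  Conversely, let \<open>w\<close> be a choice welfare function. Infinite constants are represented directly.
  Otherwise \<open>w\<close> is real-valued and convex, and separating the point \<open>(\<mu>, w \<mu>)\<close> from the strict
  epigraph yields a subgradient at every \<open>\<mu>\<close>; monotonicity makes its components nonnegative and
  translation invariance makes them sum to one (\<open>choice_welfare_subgradient\<close>). So \<open>w\<close> is the
  attained supremum of its affine minorants \<open>\<nu> \<mapsto> \<nu> \<bullet> x + c\<close> with \<open>x\<close> in the simplex. The convex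
  conjugate of \<open>w\<close> then serves as the regularization function, and each minorant is itself an
  expected maximal utility: with probability \<open>x $ i\<close>, the shock equals \<open>c\<close> in coordinate \<open>i\<close> and
  \<open>-\<infinity>\<close> in all the others, so that the maximum is \<open>\<nu> $ i + c\<close>
  (\<open>single_shock_distribution\<close>).
\<close>

section \<open>Choice welfare functions\<close>

lemma choice_welfare_functionI:
  assumes "\<And>\<mu>1 \<mu>2. \<mu>2 \<le> \<mu>1 \<Longrightarrow> w \<mu>2 \<le> w \<mu>1"
    and "\<And>\<mu> t. w (\<mu> + t *\<^sub>R (\<chi> i. 1)) = w \<mu> + ereal t"
    and "\<And>\<mu>1 \<mu>2 a. 0 \<le> a \<Longrightarrow> a \<le> 1 \<Longrightarrow>
           w (a *\<^sub>R \<mu>1 + (1 - a) *\<^sub>R \<mu>2) \<le> ereal a * w \<mu>1 + ereal (1 - a) * w \<mu>2"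
  shows "choice_welfare_function w"
  using assms unfolding choice_welfare_function_def by blast

lemma choice_welfare_functionD:
  assumes "choice_welfare_function w"
  shows "\<mu>2 \<le> \<mu>1 \<Longrightarrow> w \<mu>2 \<le> w \<mu>1"
    and "w (\<mu> + t *\<^sub>R (\<chi> i. 1)) = w \<mu> + ereal t"
    and "0 \<le> a \<Longrightarrow> a \<le> 1 \<Longrightarrow>
           w (a *\<^sub>R \<mu>1 + (1 - a) *\<^sub>R \<mu>2) \<le> ereal a * w \<mu>1 + ereal (1 - a) * w \<mu>2"
  using assms unfolding choice_welfare_function_def by blast+

lemma exists_translate_le:
  fixes \<mu> \<nu> :: "real ^ 'n"
  shows "\<exists>t. \<mu> + t *\<^sub>R (\<chi> i. 1) \<le> \<nu>"
proof
  have "\<mu> $ i - \<nu> $ i \<le> Max (range (\<lambda>i. \<mu> $ i - \<nu> $ i))" for i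
    by (intro Max_ge) auto
  then show "\<mu> + (- Max (range (\<lambda>i. \<mu> $ i - \<nu> $ i))) *\<^sub>R (\<chi> i. 1) \<le> \<nu>"
    by (simp add: less_eq_vec_def algebra_simps del: minus_Max_eq_Min)
qed

lemma infinite_imp_constant:
  fixes w :: "real ^ 'n \<Rightarrow> ereal"
  assumes mono: "\<And>\<mu>1 \<mu>2. \<mu>2 \<le> \<mu>1 \<Longrightarrow> w \<mu>2 \<le> w \<mu>1"
    and trans: "\<And>\<mu> t. w (\<mu> + t *\<^sub>R (\<chi> i. 1)) = w \<mu> + ereal t"
    and inf: "\<bar>w \<nu>\<bar> = \<infinity>"
  shows "w \<mu> = w \<nu>"
proof -
  obtain s where s: "\<nu> + s *\<^sub>R (\<chi> i. 1) \<le> \<mu>" using exists_translate_le by blast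
  obtain t where t: "\<mu> + t *\<^sub>R (\<chi> i. 1) \<le> \<nu>" using exists_translate_le by blast
  have "w \<nu> + ereal s \<le> w \<mu>" "w \<mu> + ereal t \<le> w \<nu>"
    using mono[OF s] mono[OF t] by (simp_all add: trans)
  then show ?thesis using inf by (cases "w \<nu>"; cases "w \<mu>") auto
qed

lemma ereal_convex_combination_self:
  fixes c :: ereal
  assumes "0 \<le> a" "a \<le> 1"
  shows "ereal a * c + ereal (1 - a) * c = c"
proof (cases "a = 0 \<or> a = 1")
  case True
  then show ?thesis by (auto simp: zero_ereal_def[symmetric])
next
  case False
  then have "0 < a" "0 < 1 - a" using assms by auto
  then show ?thesis
    by (cases c) (auto simp: algebra_simps)
qed

lemma choice_welfare_function_const:
  assumes "\<bar>c\<bar> = \<infinity>"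
  shows "choice_welfare_function (\<lambda>_. c)"
  using assms by (intro choice_welfare_functionI) (auto simp: ereal_convex_combination_self)

text \<open>
  The index set may be empty, with supremum \<open>-\<infinity>\<close>. The convention \<open>\<infinity> + (-\<infinity>) = \<infinity>\<close> keeps
  the addition of type \<^typ>\<open>ereal\<close> monotone, so that
  convexity needs no case distinction on infinite values.
\<close>

lemma choice_welfare_function_SUP:
  fixes f :: "'i \<Rightarrow> real ^ 'n \<Rightarrow> ereal"
  assumes "\<And>i. i \<in> I \<Longrightarrow> choice_welfare_function (f i)"
  shows "choice_welfare_function (\<lambda>\<mu>. SUP i\<in>I. f i \<mu>)"
proof (cases "I = {}")
  case True
  then show ?thesis
    using choice_welfare_function_const[of "-\<infinity>"] by (simp add: bot_ereal_def)
next
  case False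
  show ?thesis
  proof (rule choice_welfare_functionI)
    fix \<mu>1 \<mu>2 :: "real ^ 'n"
    assume "\<mu>2 \<le> \<mu>1"
    then show "(SUP i\<in>I. f i \<mu>2) \<le> (SUP i\<in>I. f i \<mu>1)"
      using choice_welfare_functionD(1)[OF assms] by (intro SUP_mono) blast
  next
    fix \<mu> :: "real ^ 'n" and t :: real
    have "(SUP i\<in>I. f i (\<mu> + t *\<^sub>R (\<chi> i. 1))) = (SUP i\<in>I. f i \<mu> + ereal t)"
      by (intro SUP_cong refl choice_welfare_functionD(2)[OF assms])
    also have "\<dots> = (SUP i\<in>I. f i \<mu>) + ereal t"
      using False by (rule SUP_ereal_add_left) simp
    finally show "(SUP i\<in>I. f i (\<mu> + t *\<^sub>R (\<chi> i. 1))) = (SUP i\<in>I. f i \<mu>) + ereal t" .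
  next
    fix \<mu>1 \<mu>2 :: "real ^ 'n" and a :: real
    assume a: "0 \<le> a" "a \<le> 1"
    show "(SUP i\<in>I. f i (a *\<^sub>R \<mu>1 + (1 - a) *\<^sub>R \<mu>2))
            \<le> ereal a * (SUP i\<in>I. f i \<mu>1) + ereal (1 - a) * (SUP i\<in>I. f i \<mu>2)"
    proof (rule SUP_least)
      fix i assume i: "i \<in> I"
      have "f i (a *\<^sub>R \<mu>1 + (1 - a) *\<^sub>R \<mu>2) \<le> ereal a * f i \<mu>1 + ereal (1 - a) * f i \<mu>2"
        using choice_welfare_functionD(3)[OF assms[OF i] a] .
      also have "\<dots> \<le> ereal a * (SUP i\<in>I. f i \<mu>1) + ereal (1 - a) * (SUP i\<in>I. f i \<mu>2)"
        using a i by (intro add_mono ereal_mult_left_mono SUP_upper) auto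
      finally show "f i (a *\<^sub>R \<mu>1 + (1 - a) *\<^sub>R \<mu>2)
        \<le> ereal a * (SUP i\<in>I. f i \<mu>1) + ereal (1 - a) * (SUP i\<in>I. f i \<mu>2)" .
    qed
  qed
qed

lemma inner_mono_simplex:
  assumes "x \<in> unit_simplex" "\<nu> \<le> \<mu>"
  shows "\<nu> \<bullet> x \<le> \<mu> \<bullet> x"
  using assms unfolding inner_vec_def unit_simplex_def
  by (auto simp: less_eq_vec_def intro!: sum_mono mult_right_mono)

lemma inner_ones_simplex:
  assumes "x \<in> unit_simplex"
  shows "(\<chi> i. 1) \<bullet> x = 1"
  using assms by (simp add: inner_vec_def unit_simplex_def)

lemma choice_welfare_function_affine:
  assumes x: "x \<in> unit_simplex"
  shows "choice_welfare_function (\<lambda>\<mu>. ereal (\<mu> \<bullet> x) - c)"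
proof (cases c)
  case (real r)
  show ?thesis
    by (rule choice_welfare_functionI)
      (auto simp: real inner_add_left inner_ones_simplex[OF x] algebra_simps
            intro: inner_mono_simplex[OF x])
qed (simp_all add: choice_welfare_function_const)

lemma axis_in_unit_simplex: "axis i 1 \<in> unit_simplex"
  by (auto simp: unit_simplex_def axis_def less_eq_vec_def)

lemma is_maximum_imp_SUP:
  fixes f :: "'a \<Rightarrow> 'b::complete_lattice"
  assumes "is_maximum m {f x | x. x \<in> S}"
  shows "m = (SUP x\<in>S. f x)"
  using assms unfolding is_maximum_def
  by (intro antisym SUP_least) (auto intro: SUP_upper)

section \<open>Subgradients and the conjugate\<close>

text \<open>A real-valued choice welfare function has at every point a subgradient in the simplex.\<close>

lemma choice_welfare_subgradient:
  fixes w :: "real ^ 'n \<Rightarrow> ereal" and f :: "real ^ 'n \<Rightarrow> real"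
  assumes w: "choice_welfare_function w" and f: "\<And>\<mu>. w \<mu> = ereal (f \<mu>)"
  obtains x where "x \<in> unit_simplex" "\<And>\<nu>. f \<mu> + (\<nu> - \<mu>) \<bullet> x \<le> f \<nu>"
proof -
  have mono: "f \<nu> \<le> f \<nu>'" if "\<nu> \<le> \<nu>'" for \<nu> \<nu>'
    using choice_welfare_functionD(1)[OF w that] by (simp add: f)
  have trans: "f (\<nu> + t *\<^sub>R (\<chi> i. 1)) = f \<nu> + t" for \<nu> t
    using choice_welfare_functionD(2)[OF w, of \<nu> t] by (simp add: f)
  have conv: "f (a *\<^sub>R \<nu> + (1 - a) *\<^sub>R \<nu>') \<le> a * f \<nu> + (1 - a) * f \<nu>'"
    if "0 \<le> a" "a \<le> 1" for a \<nu> \<nu>'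
    using choice_welfare_functionD(3)[OF w that, of \<nu> \<nu>'] by (simp add: f)
  define E where "E = {p :: (real ^ 'n) \<times> real. f (fst p) < snd p}"
  have "convex E"
    unfolding convex_alt
  proof (intro ballI allI impI)
    fix p q :: "(real ^ 'n) \<times> real" and a :: real
    assume p: "p \<in> E" and q: "q \<in> E" and a: "0 \<le> a \<and> a \<le> 1"
    have "f ((1 - a) *\<^sub>R fst p + a *\<^sub>R fst q) \<le> (1 - a) * f (fst p) + a * f (fst q)"
      using conv[of "1 - a" "fst p" "fst q"] a by simp
    also have "\<dots> < (1 - a) * snd p + a * snd q"
    proof (cases "a = 0")
      case False
      then have "a * f (fst q) < a * snd q" "(1 - a) * f (fst p) \<le> (1 - a) * snd p"
        using a p q by (auto simp: E_def intro!: mult_left_mono)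
      then show ?thesis by simp
    qed (use p in \<open>auto simp: E_def\<close>)
    finally show "(1 - a) *\<^sub>R p + a *\<^sub>R q \<in> E" by (simp add: E_def)
  qed
  moreover have "(\<mu>, f \<mu> + 1) \<in> E" by (simp add: E_def)
  moreover have "{(\<mu>, f \<mu>)} \<inter> E = {}" by (simp add: E_def)
  ultimately obtain n b where n: "n \<noteq> 0" and b: "n \<bullet> (\<mu>, f \<mu>) \<le> b" "\<And>p. p \<in> E \<Longrightarrow> b \<le> n \<bullet> p"
    using separating_hyperplane_sets[of "{(\<mu>, f \<mu>)}" E]
    by (metis convex_singleton empty_iff insertI1 insert_not_empty)
  obtain u q where nuq: "n = (u, q)" by (cases n)
  have sep: "u \<bullet> \<mu> + q * f \<mu> \<le> u \<bullet> \<nu> + q * r" if "f \<nu> < r" for \<nu> r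
    using b(1) b(2)[of "(\<nu>, r)"] that by (auto simp: nuq E_def)
  have "0 \<le> q" using sep[of \<mu> "f \<mu> + 1"] by (simp add: algebra_simps)
  \<comment> \<open>The separating hyperplane is not vertical: \<open>f\<close> is finite everywhere, so a vertical one
    would bound a nonzero linear functional from below on the whole space.\<close>
  moreover have "q \<noteq> 0"
  proof
    assume q: "q = 0"
    have "u \<bullet> \<mu> \<le> u \<bullet> (\<mu> - u)" using sep[of "\<mu> - u" "f (\<mu> - u) + 1"] q by simp
    then have "u = 0" by (simp add: inner_diff_right) (metis inner_gt_zero_iff not_le)
    then show False using n nuq q by (simp add: zero_prod_def)
  qed
  ultimately have q: "0 < q" by simp
  define x where "x = - (u /\<^sub>R q)"
  have u: "u = - (q *\<^sub>R x)" using q by (simp add: x_def)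
  have sub: "f \<mu> + (\<nu> - \<mu>) \<bullet> x \<le> f \<nu>" for \<nu>
  proof (rule field_le_epsilon)
    fix e :: real assume "0 < e"
    then have "q * (f \<mu> + (\<nu> - \<mu>) \<bullet> x) \<le> q * (f \<nu> + e)"
      using sep[of \<nu> "f \<nu> + e"] by (simp add: u algebra_simps inner_commute inner_diff_left)
    then show "f \<mu> + (\<nu> - \<mu>) \<bullet> x \<le> f \<nu> + e" using q by simp
  qed
  \<comment> \<open>Test the subgradient inequality along minus the unit vectors, where \<open>f\<close> does not increase,
    and along both signs of the all-ones vector, where \<open>f\<close> is affine.\<close>
  have "0 \<le> x $ i" for i
  proof -
    have "\<mu> - axis i 1 \<le> \<mu>" by (auto simp: less_eq_vec_def axis_def)
    from mono[OF this] sub[of "\<mu> - axis i 1"] show ?thesis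
      by (simp add: inner_axis' inner_diff_left)
  qed
  moreover have "(\<chi> i. 1) \<bullet> x = 1"
    using sub[of "\<mu> + 1 *\<^sub>R (\<chi> i. 1)"] sub[of "\<mu> + (-1) *\<^sub>R (\<chi> i. 1)"]
    unfolding trans by simp
  ultimately have "x \<in> unit_simplex"
    by (simp add: unit_simplex_def less_eq_vec_def inner_vec_def)
  then show ?thesis using sub that by blast
qed

text \<open>
  The conjugate of \<open>f\<close> is a supremum of affine functions, hence convex and lower semicontinuous.
\<close>

lemma convex_unit_simplex: "convex (unit_simplex :: (real ^ 'n) set)"
  by (auto simp: convex_alt unit_simplex_def less_eq_vec_def sum.distrib simp flip: sum_distrib_left)

lemma ereal_convex_on_SUP_affine:
  fixes f :: "real ^ 'n \<Rightarrow> real"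
  shows "ereal_convex_on unit_simplex (\<lambda>x. SUP \<mu>. ereal (\<mu> \<bullet> x - f \<mu>))"
  unfolding ereal_convex_on_def convex_alt
proof (intro ballI allI impI)
  fix p q :: "(real ^ 'n) \<times> real" and a :: real
  let ?E = "ereal_epigraph unit_simplex (\<lambda>x. SUP \<mu>. ereal (\<mu> \<bullet> x - f \<mu>))"
  assume p: "p \<in> ?E" and q: "q \<in> ?E" and a: "0 \<le> a \<and> a \<le> 1"
  have "\<mu> \<bullet> ((1 - a) *\<^sub>R fst p + a *\<^sub>R fst q) - f \<mu> \<le> (1 - a) * snd p + a * snd q" for \<mu>
  proof -
    have "\<mu> \<bullet> fst p - f \<mu> \<le> snd p" "\<mu> \<bullet> fst q - f \<mu> \<le> snd q"
      using p q by (auto simp: ereal_epigraph_def SUP_le_iff)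
    then have "(1 - a) * (\<mu> \<bullet> fst p - f \<mu>) + a * (\<mu> \<bullet> fst q - f \<mu>) \<le> (1 - a) * snd p + a * snd q"
      using a by (intro add_mono mult_left_mono) auto
    then show ?thesis by (simp add: inner_add_right algebra_simps)
  qed
  moreover have "(1 - a) *\<^sub>R fst p + a *\<^sub>R fst q \<in> unit_simplex"
    using p q a by (auto simp: ereal_epigraph_def unit_simplex_def less_eq_vec_def sum.distrib
        simp flip: sum_distrib_left)
  ultimately show "(1 - a) *\<^sub>R p + a *\<^sub>R q \<in> ?E"
    by (auto simp: ereal_epigraph_def SUP_le_iff case_prod_beta)
qed

lemma lower_semicontinuous_on_SUP_affine:
  fixes f :: "'a::real_inner \<Rightarrow> real"
  shows "lower_semicontinuous_on S (\<lambda>x. SUP \<mu>. ereal (\<mu> \<bullet> x - f \<mu>))"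
  unfolding lower_semicontinuous_on_def le_Liminf_iff
proof (intro ballI allI impI)
  fix x y assume "y < (SUP \<mu>. ereal (\<mu> \<bullet> x - f \<mu>))"
  then obtain \<mu> where \<mu>: "y < ereal (\<mu> \<bullet> x - f \<mu>)" by (auto simp: less_SUP_iff)
  have "((\<lambda>z. ereal (\<mu> \<bullet> z - f \<mu>)) \<longlongrightarrow> ereal (\<mu> \<bullet> x - f \<mu>)) (at x within S)"
    by (intro tendsto_intros)
  from order_tendstoD(1)[OF this \<mu>]
  show "\<forall>\<^sub>F z in at x within S. y < (SUP \<mu>. ereal (\<mu> \<bullet> z - f \<mu>))"
    by eventually_elim (auto simp: less_SUP_iff)
qed

lemma choice_welfare_regularization:
  fixes w :: "real ^ 'n \<Rightarrow> ereal"
  assumes w: "choice_welfare_function w"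
  shows "\<exists>V. ereal_convex_on unit_simplex V \<and> lower_semicontinuous_on unit_simplex V \<and>
           (\<forall>\<mu>. is_maximum (w \<mu>) {ereal (\<mu> \<bullet> x) - V x | x. x \<in> unit_simplex})"
proof (cases "\<exists>\<nu>. \<bar>w \<nu>\<bar> = \<infinity>")
  case True
  then obtain \<nu> where \<nu>: "\<bar>w \<nu>\<bar> = \<infinity>" by (elim exE)
  have const: "w \<mu> = w \<nu>" for \<mu>
    by (rule infinite_imp_constant[where w = w, OF choice_welfare_functionD(1,2)[OF w] \<nu>])
  have "ereal_epigraph unit_simplex (\<lambda>x :: real ^ 'n. - w \<nu>)
          = (if w \<nu> = \<infinity> then unit_simplex \<times> UNIV else {})"
    using \<nu> by (cases "w \<nu>") (auto simp: ereal_epigraph_def)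
  then have "ereal_convex_on unit_simplex (\<lambda>x :: real ^ 'n. - w \<nu>)"
    by (simp add: ereal_convex_on_def convex_Times convex_unit_simplex)
  moreover have "lower_semicontinuous_on unit_simplex (\<lambda>x :: real ^ 'n. - w \<nu>)"
    by (auto simp: lower_semicontinuous_on_def le_Liminf_iff)
  moreover have "is_maximum (w \<mu>) {ereal (\<mu> \<bullet> x) - (- w \<nu>) | x. x \<in> unit_simplex}" for \<mu>
    using \<nu> axis_in_unit_simplex const[of \<mu>] by (cases "w \<nu>") (auto simp: is_maximum_def)
  ultimately show ?thesis by blast
next
  case False
  define f where "f \<mu> = real_of_ereal (w \<mu>)" for \<mu>
  have f: "w \<mu> = ereal (f \<mu>)" for \<mu> using False by (simp add: f_def ereal_real')
  define V where "V x = (SUP \<mu>. ereal (\<mu> \<bullet> x - f \<mu>))" for x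
  have "is_maximum (w \<mu>) {ereal (\<mu> \<bullet> x) - V x | x. x \<in> unit_simplex}" for \<mu>
  proof -
    obtain x where x: "x \<in> unit_simplex" and sub: "\<And>\<nu>. f \<mu> + (\<nu> - \<mu>) \<bullet> x \<le> f \<nu>"
      using choice_welfare_subgradient[OF w f] by metis
    \<comment> \<open>At a subgradient of \<open>f\<close> at \<open>\<mu>\<close>, the supremum that defines \<open>V\<close> is attained at \<open>\<mu>\<close>.\<close>
    have "V x = ereal (\<mu> \<bullet> x - f \<mu>)"
      unfolding V_def
    proof (intro antisym SUP_least)
      fix \<nu> show "ereal (\<nu> \<bullet> x - f \<nu>) \<le> ereal (\<mu> \<bullet> x - f \<mu>)"
        using sub[of \<nu>] by (simp add: inner_diff_left)
    qed (auto intro: SUP_upper)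
    then have "w \<mu> = ereal (\<mu> \<bullet> x) - V x" by (simp add: f)
    moreover have "ereal (\<mu> \<bullet> y) - V y \<le> w \<mu>" for y
    proof -
      have "ereal (\<mu> \<bullet> y - f \<mu>) \<le> V y" unfolding V_def by (auto intro: SUP_upper)
      then show ?thesis by (cases "V y") (auto simp: f)
    qed
    ultimately show ?thesis using x by (auto simp: is_maximum_def)
  qed
  moreover have "ereal_convex_on unit_simplex V" "lower_semicontinuous_on unit_simplex V"
    unfolding V_def by (rule ereal_convex_on_SUP_affine lower_semicontinuous_on_SUP_affine)+
  ultimately show ?thesis by blast
qed

section \<open>Expectations of extended-real-valued functions\<close>

lemma ereal_expectation_mono:
  assumes "\<And>x. f x \<le> g x"
  shows "ereal_expectation M f \<le> ereal_expectation M g"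
  unfolding ereal_expectation_def
  by (intro ereal_minus_mono)
    (auto simp flip: less_eq_ennreal.rep_eq intro!: nn_integral_mono e2ennreal_mono assms)

text \<open>
  If the positive and the negative part both have finite integrals, the expectation is an
  ordinary Bochner integral.
\<close>

lemma ereal_expectation_finite:
  assumes f: "f \<in> borel_measurable M"
    and fin: "(\<integral>\<^sup>+ x. e2ennreal (f x) \<partial>M) < \<infinity>" "(\<integral>\<^sup>+ x. e2ennreal (- f x) \<partial>M) < \<infinity>"
  shows "AE x in M. \<bar>f x\<bar> \<noteq> \<infinity>"
    and "integrable M (\<lambda>x. real_of_ereal (f x))"
    and "ereal_expectation M f = ereal (\<integral>x. real_of_ereal (f x) \<partial>M)"
proof -
  note [measurable] = f
  have "AE x in M. e2ennreal (f x) \<noteq> \<infinity>" "AE x in M. e2ennreal (- f x) \<noteq> \<infinity>"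
    using fin by (auto intro!: nn_integral_noteq_infinite simp del: infinity_ennreal_def)
  then show ae: "AE x in M. \<bar>f x\<bar> \<noteq> \<infinity>"
  proof eventually_elim
    case (elim x) then show ?case by (cases "f x") (auto simp: e2ennreal_infty)
  qed
  have pos: "(\<integral>\<^sup>+ x. ennreal (real_of_ereal (f x)) \<partial>M) = (\<integral>\<^sup>+ x. e2ennreal (f x) \<partial>M)"
    using ae by (intro nn_integral_cong_AE, eventually_elim) (metis e2ennreal_ereal ereal_real')
  have neg: "(\<integral>\<^sup>+ x. ennreal (- real_of_ereal (f x)) \<partial>M) = (\<integral>\<^sup>+ x. e2ennreal (- f x) \<partial>M)"
    using ae by (intro nn_integral_cong_AE, eventually_elim)
      (metis e2ennreal_ereal ereal_real' uminus_ereal.simps(1))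
  show int: "integrable M (\<lambda>x. real_of_ereal (f x))"
    using fin by (simp add: real_integrable_def pos neg less_top)
  show "ereal_expectation M f = ereal (\<integral>x. real_of_ereal (f x) \<partial>M)"
  proof -
    obtain P N where PN: "0 \<le> P" "(\<integral>\<^sup>+ x. e2ennreal (f x) \<partial>M) = ennreal P"
      "0 \<le> N" "(\<integral>\<^sup>+ x. e2ennreal (- f x) \<partial>M) = ennreal N"
      using fin by (auto simp: less_top_ennreal)
    show ?thesis
      unfolding ereal_expectation_def real_lebesgue_integral_def[OF int] pos neg
      using PN by simp
  qed
qed

lemma nn_integrals_finite:
  assumes "has_ereal_expectation M f" "\<bar>ereal_expectation M f\<bar> \<noteq> \<infinity>"
  shows "(\<integral>\<^sup>+ x. e2ennreal (f x) \<partial>M) < \<infinity>" "(\<integral>\<^sup>+ x. e2ennreal (- f x) \<partial>M) < \<infinity>"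
  using assms unfolding has_ereal_expectation_def ereal_expectation_def
  by (cases "\<integral>\<^sup>+ x. e2ennreal (f x) \<partial>M"; cases "\<integral>\<^sup>+ x. e2ennreal (- f x) \<partial>M"; auto)+

lemma nn_integral_e2ennreal_add_const_le:
  assumes "prob_space M" and [measurable]: "f \<in> borel_measurable M"
  shows "(\<integral>\<^sup>+ x. e2ennreal (f x + ereal t) \<partial>M) \<le> (\<integral>\<^sup>+ x. e2ennreal (f x) \<partial>M) + ennreal \<bar>t\<bar>"
proof -
  interpret prob_space M by fact
  have "e2ennreal (y + ereal t) \<le> e2ennreal y + ennreal \<bar>t\<bar>" for y
  proof (cases y)
    case (real r)
    then show ?thesis
      by (cases "0 \<le> r") (auto simp: ennreal_neg simp flip: ennreal_plus intro!: ennreal_leI)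
  qed (auto simp: e2ennreal_infty e2ennreal_neg)
  then have "(\<integral>\<^sup>+ x. e2ennreal (f x + ereal t) \<partial>M) \<le> (\<integral>\<^sup>+ x. e2ennreal (f x) + ennreal \<bar>t\<bar> \<partial>M)"
    by (intro nn_integral_mono)
  also have "\<dots> = (\<integral>\<^sup>+ x. e2ennreal (f x) \<partial>M) + ennreal \<bar>t\<bar>"
    by (simp add: nn_integral_add emeasure_space_1)
  finally show ?thesis .
qed

text \<open>
  Adding a constant does not change which of the two parts has an infinite integral; this
  reduces translation of infinite expectations to a case distinction.
\<close>

lemma nn_integral_e2ennreal_add_const_infinite_iff:
  assumes M: "prob_space M" and f[measurable]: "f \<in> borel_measurable M"
  shows "(\<integral>\<^sup>+ x. e2ennreal (f x + ereal t) \<partial>M) = \<infinity> \<longleftrightarrow> (\<integral>\<^sup>+ x. e2ennreal (f x) \<partial>M) = \<infinity>"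
proof -
  have "f x + ereal t + ereal (- t) = f x" for x
    by (cases "f x") auto
  then have "(\<integral>\<^sup>+ x. e2ennreal (f x) \<partial>M) \<le> (\<integral>\<^sup>+ x. e2ennreal (f x + ereal t) \<partial>M) + ennreal \<bar>t\<bar>"
    using nn_integral_e2ennreal_add_const_le[OF M, of "\<lambda>x. f x + ereal t" "- t"] by simp
  then show ?thesis
    using nn_integral_e2ennreal_add_const_le[OF M f, of t] by (auto simp: top_unique)
qed

lemma ereal_expectation_add_const:
  assumes M: "prob_space M" and f: "has_ereal_expectation M f"
  shows "ereal_expectation M (\<lambda>x. f x + ereal t) = ereal_expectation M f + ereal t"
proof -
  interpret prob_space M by fact
  have [measurable]: "f \<in> borel_measurable M" using f by (simp add: has_ereal_expectation_def)
  define P where "P g = (\<integral>\<^sup>+ x. e2ennreal (g x) \<partial>M)" for g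
  define N where "N g = (\<integral>\<^sup>+ x. e2ennreal (- g x) \<partial>M)" for g
  let ?g = "\<lambda>x. f x + ereal t"
  have E: "ereal_expectation M g = enn2ereal (P g) - enn2ereal (N g)" for g
    by (simp add: ereal_expectation_def P_def N_def)
  have P: "P ?g = \<infinity> \<longleftrightarrow> P f = \<infinity>"
    unfolding P_def by (intro nn_integral_e2ennreal_add_const_infinite_iff M) measurable
  have "- (y + ereal t) = - y + ereal (- t)" for y by (cases y) auto
  then have N: "N ?g = \<infinity> \<longleftrightarrow> N f = \<infinity>"
    unfolding N_def
    using nn_integral_e2ennreal_add_const_infinite_iff[OF M, of "\<lambda>x. - f x" "- t"] by simp
  consider "P f = \<infinity>" | "P f \<noteq> \<infinity>" "N f = \<infinity>" | "P f \<noteq> \<infinity>" "N f \<noteq> \<infinity>" by blast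
  then show ?thesis
  proof cases
    case 1
    then show ?thesis using P by (simp add: E)
  next
    case 2
    then show ?thesis using P N
      by (cases "P f"; cases "P ?g") (simp_all add: E)
  next
    case 3
    then have fin: "P f < \<infinity>" "N f < \<infinity>" "P ?g < \<infinity>" "N ?g < \<infinity>"
      using P N by (auto simp: less_top)
    have meas: "f \<in> borel_measurable M" "?g \<in> borel_measurable M" by measurable
    note ff = ereal_expectation_finite[OF meas(1) fin(1,2)[unfolded P_def N_def]]
    note gg = ereal_expectation_finite[OF meas(2) fin(3,4)[unfolded P_def N_def]]
    have "(\<integral>x. real_of_ereal (?g x) \<partial>M) = (\<integral>x. real_of_ereal (f x) + t \<partial>M)"
    proof (rule integral_cong_AE)
      show "AE x in M. real_of_ereal (?g x) = real_of_ereal (f x) + t"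
        using ff(1) by eventually_elim (auto simp: real_of_ereal_add)
    qed measurable
    then show ?thesis
      using ff(2) by (simp add: ff(3) gg(3) prob_space)
  qed
qed

section \<open>Random utility representations\<close>

lemma max_utility_leI: "(\<And>i. ereal (\<mu> $ i) + \<epsilon> $ i \<le> m) \<Longrightarrow> max_utility \<mu> \<epsilon> \<le> m"
  unfolding max_utility_def by (intro Max.boundedI) auto

lemma le_max_utility: "ereal (\<mu> $ i) + \<epsilon> $ i \<le> max_utility \<mu> \<epsilon>"
  unfolding max_utility_def by (intro Max_ge) auto

lemma max_utility_mono:
  assumes "\<mu> \<le> \<nu>"
  shows "max_utility \<mu> \<epsilon> \<le> max_utility \<nu> \<epsilon>"
proof (rule max_utility_leI)
  fix i
  have "ereal (\<mu> $ i) + \<epsilon> $ i \<le> ereal (\<nu> $ i) + \<epsilon> $ i"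
    using assms by (intro add_right_mono) (simp add: less_eq_vec_def)
  also have "\<dots> \<le> max_utility \<nu> \<epsilon>" by (rule le_max_utility)
  finally show "ereal (\<mu> $ i) + \<epsilon> $ i \<le> max_utility \<nu> \<epsilon>" .
qed

lemma max_utility_translate:
  "max_utility (\<mu> + t *\<^sub>R (\<chi> i. 1)) \<epsilon> = max_utility \<mu> \<epsilon> + ereal t"
proof -
  have "mono (\<lambda>y. y + ereal t)" by (intro monoI add_right_mono)
  then have "max_utility \<mu> \<epsilon> + ereal t = (MAX i. ereal (\<mu> $ i) + \<epsilon> $ i + ereal t)"
    unfolding max_utility_def by (subst mono_Max_commute) (auto simp: image_image)
  also have "\<dots> = max_utility (\<mu> + t *\<^sub>R (\<chi> i. 1)) \<epsilon>"
    unfolding max_utility_def by (simp add: ac_simps flip: plus_ereal.simps(1))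
  finally show ?thesis ..
qed

lemma real_max_utility_convex:
  assumes a: "0 \<le> a" "a \<le> 1"
    and fin: "\<bar>max_utility \<mu> \<epsilon>\<bar> \<noteq> \<infinity>" "\<bar>max_utility \<nu> \<epsilon>\<bar> \<noteq> \<infinity>"
      "\<bar>max_utility (a *\<^sub>R \<mu> + (1 - a) *\<^sub>R \<nu>) \<epsilon>\<bar> \<noteq> \<infinity>"
  shows "real_of_ereal (max_utility (a *\<^sub>R \<mu> + (1 - a) *\<^sub>R \<nu>) \<epsilon>)
           \<le> a * real_of_ereal (max_utility \<mu> \<epsilon>) + (1 - a) * real_of_ereal (max_utility \<nu> \<epsilon>)"
proof -
  obtain p q where pq: "max_utility \<mu> \<epsilon> = ereal p" "max_utility \<nu> \<epsilon> = ereal q"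
    using fin by (metis ereal_real')
  have "max_utility (a *\<^sub>R \<mu> + (1 - a) *\<^sub>R \<nu>) \<epsilon> \<le> ereal (a * p + (1 - a) * q)"
  proof (rule max_utility_leI)
    fix i
    have le: "ereal (\<mu> $ i) + \<epsilon> $ i \<le> ereal p" "ereal (\<nu> $ i) + \<epsilon> $ i \<le> ereal q"
      using le_max_utility[of \<mu> i \<epsilon>] le_max_utility[of \<nu> i \<epsilon>] pq by auto
    show "ereal ((a *\<^sub>R \<mu> + (1 - a) *\<^sub>R \<nu>) $ i) + \<epsilon> $ i \<le> ereal (a * p + (1 - a) * q)"
    proof (cases "\<epsilon> $ i")
      case (real e)
      then have "a * (\<mu> $ i + e) + (1 - a) * (\<nu> $ i + e) \<le> a * p + (1 - a) * q"
        using le a by (intro add_mono mult_left_mono) auto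
      then show ?thesis by (simp add: real algebra_simps)
    qed (use le in auto)
  qed
  then show ?thesis using fin(3) pq by (cases "max_utility (a *\<^sub>R \<mu> + (1 - a) *\<^sub>R \<nu>) \<epsilon>") auto
qed

lemma choice_welfare_function_expectation:
  fixes \<theta> :: "(ereal ^ 'n) measure"
  assumes "admissible_distribution \<theta>"
  shows "choice_welfare_function (\<lambda>\<mu>. ereal_expectation \<theta> (max_utility \<mu>))"
proof -
  have ps: "prob_space \<theta>" and ex: "has_ereal_expectation \<theta> (max_utility \<mu>)" for \<mu>
    using assms by (auto simp: admissible_distribution_def)
  interpret prob_space \<theta> by (rule ps)
  define w where "w \<mu> = ereal_expectation \<theta> (max_utility \<mu>)" for \<mu>
  have mono: "w \<mu> \<le> w \<nu>" if "\<mu> \<le> \<nu>" for \<mu> \<nu>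
    unfolding w_def by (intro ereal_expectation_mono max_utility_mono that)
  have trans: "w (\<mu> + t *\<^sub>R (\<chi> i. 1)) = w \<mu> + ereal t" for \<mu> t
    unfolding w_def max_utility_translate by (rule ereal_expectation_add_const[OF ps ex])
  have "choice_welfare_function w"
  proof (cases "\<exists>\<nu>. \<bar>w \<nu>\<bar> = \<infinity>")
    case True
    then obtain \<nu> where \<nu>: "\<bar>w \<nu>\<bar> = \<infinity>" by (elim exE)
    have "w = (\<lambda>_. w \<nu>)"
      using infinite_imp_constant[where w = w, OF mono trans \<nu>] by blast
    then show ?thesis using choice_welfare_function_const[OF \<nu>]
      by (rule ssubst[where P = choice_welfare_function])
  next
    case False
    have meas: "max_utility \<mu> \<in> borel_measurable \<theta>" for \<mu>
      using ex by (simp add: has_ereal_expectation_def)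
    have "(\<integral>\<^sup>+ x. e2ennreal (max_utility \<mu> x) \<partial>\<theta>) < \<infinity>"
      "(\<integral>\<^sup>+ x. e2ennreal (- max_utility \<mu> x) \<partial>\<theta>) < \<infinity>" for \<mu>
      using False nn_integrals_finite[OF ex] by (auto simp: w_def)
    note fin = ereal_expectation_finite[OF meas this]
    show ?thesis
    proof (rule choice_welfare_functionI[OF mono trans])
      fix \<mu>1 \<mu>2 :: "real ^ 'n" and a :: real
      assume a: "0 \<le> a" "a \<le> 1"
      let ?F = "\<lambda>\<mu> \<epsilon>. real_of_ereal (max_utility \<mu> \<epsilon>)"
      have "(\<integral>\<epsilon>. ?F (a *\<^sub>R \<mu>1 + (1 - a) *\<^sub>R \<mu>2) \<epsilon> \<partial>\<theta>)
              \<le> (\<integral>\<epsilon>. a * ?F \<mu>1 \<epsilon> + (1 - a) * ?F \<mu>2 \<epsilon> \<partial>\<theta>)"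
      proof (rule integral_mono_AE)
        show "AE \<epsilon> in \<theta>. ?F (a *\<^sub>R \<mu>1 + (1 - a) *\<^sub>R \<mu>2) \<epsilon> \<le> a * ?F \<mu>1 \<epsilon> + (1 - a) * ?F \<mu>2 \<epsilon>"
          using fin(1)[of \<mu>1] fin(1)[of \<mu>2] fin(1)[of "a *\<^sub>R \<mu>1 + (1 - a) *\<^sub>R \<mu>2"]
          by eventually_elim (rule real_max_utility_convex[OF a])
      qed (auto intro!: fin(2))
      also have "\<dots> = a * (\<integral>\<epsilon>. ?F \<mu>1 \<epsilon> \<partial>\<theta>) + (1 - a) * (\<integral>\<epsilon>. ?F \<mu>2 \<epsilon> \<partial>\<theta>)"
        by (simp add: fin(2))
      finally show "w (a *\<^sub>R \<mu>1 + (1 - a) *\<^sub>R \<mu>2) \<le> ereal a * w \<mu>1 + ereal (1 - a) * w \<mu>2"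
        by (simp add: w_def fin(3))
    qed
  qed
  then show ?thesis by (simp add: w_def[abs_def])
qed

lemma borel_measurable_max_utility: "max_utility \<mu> \<in> borel_measurable borel"
proof -
  have "(\<lambda>\<epsilon> :: ereal ^ 'a. \<epsilon> $ i) \<in> borel_measurable borel" for i
    by (intro borel_measurable_continuous_onI continuous_intros)
  moreover have "max_utility \<mu> = (\<lambda>\<epsilon>. SUP i. ereal (\<mu> $ i) + \<epsilon> $ i)"
    unfolding max_utility_def by (simp add: Max_Sup)
  ultimately show ?thesis by simp
qed

text \<open>
  The shock with value \<open>c\<close> in coordinate \<open>i\<close> and \<open>-\<infinity>\<close> elsewhere, which makes alternative \<open>i\<close>
  the best one for every \<open>\<mu>\<close>.
\<close>

definition single_shock :: "real \<Rightarrow> 'n \<Rightarrow> ereal ^ 'n" where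
  "single_shock c i = (\<chi> j. if j = i then ereal c else - \<infinity>)"

text \<open>
  The distribution of \<^term>\<open>single_shock c i\<close> for \<open>i\<close> drawn with probability \<open>x $ i\<close>. It is
  meaningful for \<open>x\<close> in the simplex only; otherwise \<^const>\<open>embed_pmf\<close> is unspecified.
\<close>

definition single_shock_distribution :: "real ^ 'n \<Rightarrow> real \<Rightarrow> (ereal ^ 'n) measure" where
  "single_shock_distribution x c = distr (measure_pmf (embed_pmf (($) x))) borel (single_shock c)"

lemma max_utility_single_shock: "max_utility \<mu> (single_shock c i) = ereal (\<mu> $ i + c)"
proof (rule antisym)
  show "max_utility \<mu> (single_shock c i) \<le> ereal (\<mu> $ i + c)"
    by (rule max_utility_leI) (simp add: single_shock_def)
  show "ereal (\<mu> $ i + c) \<le> max_utility \<mu> (single_shock c i)"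
    using le_max_utility[of \<mu> i "single_shock c i"] by (simp add: single_shock_def)
qed

lemma single_shock_distribution:
  fixes x :: "real ^ 'n"
  assumes x: "x \<in> unit_simplex"
  shows "admissible_distribution (single_shock_distribution x c)"
    and "ereal_expectation (single_shock_distribution x c) (max_utility \<mu>) = ereal (\<mu> \<bullet> x + c)"
proof -
  define p where "p = embed_pmf (($) x)"
  let ?D = "single_shock_distribution x c"
  have D: "?D = distr (measure_pmf p) borel (single_shock c)"
    by (simp add: single_shock_distribution_def p_def)
  have x0: "0 \<le> x $ i" for i using x by (simp add: unit_simplex_def less_eq_vec_def)
  have x1: "(\<Sum>i\<in>UNIV. x $ i) = 1" using x by (simp add: unit_simplex_def)
  have p: "pmf p i = x $ i" for i
    unfolding p_def
    by (rule pmf_embed_pmf) (simp_all add: x0 x1 nn_integral_count_space_finite sum_ennreal)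
  have meas: "max_utility \<mu> \<in> borel_measurable ?D" for \<mu>
    using borel_measurable_max_utility by (simp add: D)
  have nn: "(\<integral>\<^sup>+ \<epsilon>. e2ennreal (g (max_utility \<mu> \<epsilon>)) \<partial>?D)
              = (\<integral>\<^sup>+ i. e2ennreal (g (ereal (\<mu> $ i + c))) \<partial>p)"
    if [measurable]: "g \<in> borel_measurable borel" for g \<mu>
    using borel_measurable_max_utility[of \<mu>, measurable]
    unfolding D by (subst nn_integral_distr) (simp_all add: max_utility_single_shock)
  have "integrable p (\<lambda>i. \<mu> $ i + c)" for \<mu> :: "real ^ 'n"
    by (rule integrable_measure_pmf_finite) simp
  then have fin: "(\<integral>\<^sup>+ \<epsilon>. e2ennreal (max_utility \<mu> \<epsilon>) \<partial>?D) < \<infinity>"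
      "(\<integral>\<^sup>+ \<epsilon>. e2ennreal (- max_utility \<mu> \<epsilon>) \<partial>?D) < \<infinity>" for \<mu>
    using nn[of "\<lambda>y. y" \<mu>] nn[of "\<lambda>y. - y" \<mu>] by (simp_all add: real_integrable_def less_top)
  show "admissible_distribution ?D"
    unfolding admissible_distribution_def has_ereal_expectation_def
    using fin(1) meas by (auto simp: D intro!: measure_pmf.prob_space_distr)
  have "ereal_expectation ?D (max_utility \<mu>) = ereal (\<integral>\<epsilon>. real_of_ereal (max_utility \<mu> \<epsilon>) \<partial>?D)"
    by (rule ereal_expectation_finite(3)[OF meas fin])
  also have "(\<integral>\<epsilon>. real_of_ereal (max_utility \<mu> \<epsilon>) \<partial>?D) = (\<integral>i. \<mu> $ i + c \<partial>p)"
    using borel_measurable_max_utility[of \<mu>, measurable]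
    unfolding D by (subst integral_distr) (simp_all add: max_utility_single_shock)
  also have "\<dots> = (\<Sum>i\<in>UNIV. (\<mu> $ i + c) * x $ i)"
    by (subst integral_measure_pmf_real[of UNIV]) (simp_all add: p)
  also have "\<dots> = \<mu> \<bullet> x + c"
    by (simp add: inner_vec_def distrib_right sum.distrib x1 flip: sum_distrib_left)
  finally show "ereal_expectation ?D (max_utility \<mu>) = ereal (\<mu> \<bullet> x + c)" .
qed

text \<open>The point mass at the vector with all components \<open>\<infinity>\<close> represents the constant \<open>\<infinity>\<close>.\<close>

lemma admissible_dirac_infinity:
  fixes \<epsilon>\<^sub>0 :: "ereal ^ 'n"
  defines "\<epsilon>\<^sub>0 \<equiv> (\<chi> i. \<infinity>)"
  shows "admissible_distribution (return borel \<epsilon>\<^sub>0)"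
    and "ereal_expectation (return borel \<epsilon>\<^sub>0) (max_utility \<mu>) = \<infinity>"
proof -
  have top: "max_utility \<mu> \<epsilon>\<^sub>0 = \<infinity>" for \<mu>
    using le_max_utility[of \<mu> undefined \<epsilon>\<^sub>0] by (simp add: \<epsilon>\<^sub>0_def)
  note [measurable] = borel_measurable_max_utility
  have nn: "(\<integral>\<^sup>+ \<epsilon>. e2ennreal (max_utility \<mu> \<epsilon>) \<partial>return borel \<epsilon>\<^sub>0) = \<infinity>"
     "(\<integral>\<^sup>+ \<epsilon>. e2ennreal (- max_utility \<mu> \<epsilon>) \<partial>return borel \<epsilon>\<^sub>0) = 0" for \<mu>
    by (subst nn_integral_return; simp add: top e2ennreal_neg)+
  show "admissible_distribution (return borel \<epsilon>\<^sub>0)"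
    by (auto simp: admissible_distribution_def has_ereal_expectation_def nn intro!: prob_space_return)
  show "ereal_expectation (return borel \<epsilon>\<^sub>0) (max_utility \<mu>) = \<infinity>"
    by (simp add: ereal_expectation_def nn)
qed

lemma choice_welfare_random_utility:
  fixes w :: "real ^ 'n \<Rightarrow> ereal"
  assumes w: "choice_welfare_function w"
  shows "\<exists>\<Theta>. (\<forall>\<theta>\<in>\<Theta>. admissible_distribution \<theta>) \<and>
           (\<forall>\<mu>. w \<mu> = (SUP \<theta>\<in>\<Theta>. ereal_expectation \<theta> (max_utility \<mu>)))"
proof (cases "\<exists>\<nu>. \<bar>w \<nu>\<bar> = \<infinity>")
  case True
  then obtain \<nu> where \<nu>: "\<bar>w \<nu>\<bar> = \<infinity>" by (elim exE)
  have const: "w \<mu> = w \<nu>" for \<mu>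
    by (rule infinite_imp_constant[where w = w, OF choice_welfare_functionD(1,2)[OF w] \<nu>])
  show ?thesis
  proof (cases "w \<nu> = \<infinity>")
    case True
    then show ?thesis using const
      by (intro exI[of _ "{return borel (\<chi> i. \<infinity>)}"]) (simp add: admissible_dirac_infinity)
  next
    case False
    \<comment> \<open>The supremum over no distribution at all is \<open>-\<infinity>\<close>.\<close>
    then show ?thesis using const \<nu> by (intro exI[of _ "{}"]) (auto simp: bot_ereal_def)
  qed
next
  case False
  define f where "f \<mu> = real_of_ereal (w \<mu>)" for \<mu>
  have f: "w \<mu> = ereal (f \<mu>)" for \<mu> using False by (simp add: f_def ereal_real')
  define \<Theta> where "\<Theta> = {single_shock_distribution x c | x c. x \<in> unit_simplex \<and> (\<forall>\<nu>. \<nu> \<bullet> x + c \<le> f \<nu>)}"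
  have "w \<mu> = (SUP \<theta>\<in>\<Theta>. ereal_expectation \<theta> (max_utility \<mu>))" for \<mu>
  proof (rule antisym)
    obtain x where x: "x \<in> unit_simplex" and sub: "\<And>\<nu>. f \<mu> + (\<nu> - \<mu>) \<bullet> x \<le> f \<nu>"
      using choice_welfare_subgradient[OF w f] by metis
    have "\<nu> \<bullet> x + (f \<mu> - \<mu> \<bullet> x) \<le> f \<nu>" for \<nu>
      using sub[of \<nu>] by (simp add: inner_diff_left)
    then have "single_shock_distribution x (f \<mu> - \<mu> \<bullet> x) \<in> \<Theta>" using x by (auto simp: \<Theta>_def)
    then show "w \<mu> \<le> (SUP \<theta>\<in>\<Theta>. ereal_expectation \<theta> (max_utility \<mu>))"
      by (rule SUP_upper2) (simp add: single_shock_distribution(2)[OF x] f)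
    show "(SUP \<theta>\<in>\<Theta>. ereal_expectation \<theta> (max_utility \<mu>)) \<le> w \<mu>"
      by (rule SUP_least) (auto simp: \<Theta>_def single_shock_distribution(2) f)
  qed
  moreover have "\<forall>\<theta>\<in>\<Theta>. admissible_distribution \<theta>"
    by (auto simp: \<Theta>_def single_shock_distribution(1))
  ultimately show ?thesis by blast
qed

theorem theorem1:
  fixes w :: "real ^ 'n \<Rightarrow> ereal"
  shows "(choice_welfare_function w \<longleftrightarrow>
           (\<exists>V :: real ^ 'n \<Rightarrow> ereal.
              ereal_convex_on unit_simplex V \<and> lower_semicontinuous_on unit_simplex V \<and>
              (\<forall>\<mu>. is_maximum (w \<mu>) {ereal (\<mu> \<bullet> x) - V x | x. x \<in> unit_simplex})))
       \<and> (choice_welfare_function w \<longleftrightarrow>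
           (\<exists>\<Theta> :: (ereal ^ 'n) measure set.
              (\<forall>\<theta>\<in>\<Theta>. admissible_distribution \<theta>) \<and>
              (\<forall>\<mu>. w \<mu> = (SUP \<theta>\<in>\<Theta>. ereal_expectation \<theta> (max_utility \<mu>)))))"
proof (intro conjI iffI)
  assume "\<exists>V :: real ^ 'n \<Rightarrow> ereal.
    ereal_convex_on unit_simplex V \<and> lower_semicontinuous_on unit_simplex V \<and>
    (\<forall>\<mu>. is_maximum (w \<mu>) {ereal (\<mu> \<bullet> x) - V x | x. x \<in> unit_simplex})"
  then obtain V :: "real ^ 'n \<Rightarrow> ereal" where
    "\<And>\<mu>. is_maximum (w \<mu>) {ereal (\<mu> \<bullet> x) - V x | x. x \<in> unit_simplex}" by blast
  then have "w = (\<lambda>\<mu>. SUP x\<in>unit_simplex. ereal (\<mu> \<bullet> x) - V x)"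
    by (intro ext is_maximum_imp_SUP)
  then show "choice_welfare_function w"
    by (simp add: choice_welfare_function_SUP choice_welfare_function_affine)
next
  assume "\<exists>\<Theta> :: (ereal ^ 'n) measure set. (\<forall>\<theta>\<in>\<Theta>. admissible_distribution \<theta>) \<and>
    (\<forall>\<mu>. w \<mu> = (SUP \<theta>\<in>\<Theta>. ereal_expectation \<theta> (max_utility \<mu>)))"
  then obtain \<Theta> :: "(ereal ^ 'n) measure set" where
    \<Theta>: "\<And>\<theta>. \<theta> \<in> \<Theta> \<Longrightarrow> admissible_distribution \<theta>"
    and "\<And>\<mu>. w \<mu> = (SUP \<theta>\<in>\<Theta>. ereal_expectation \<theta> (max_utility \<mu>))" by blast
  then have "w = (\<lambda>\<mu>. SUP \<theta>\<in>\<Theta>. ereal_expectation \<theta> (max_utility \<mu>))" by blast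
  then show "choice_welfare_function w"
    by (simp add: choice_welfare_function_SUP choice_welfare_function_expectation \<Theta>)
qed (simp_all only: choice_welfare_regularization choice_welfare_random_utility)

end
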